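(* Consider $N$ steps of the Arnoldi method applied to $A_m\in\mathbb{C}^{(n+m)\times(n+m)}$ with starting vector $b=[u_0^{\mathrm T},e_1^{\mathrm T}]^{\mathrm T}\in\mathbb{C}^{n+m}$, producing $Q_N$, $F_N$, and let $u_{N,m}$ be the corresponding Krylov approximation, i.e. $u_{N,m}:=\begin{bmatrix}I_n&0\end{bmatrix}Q_N\exp(tF_N)e_1\beta$ with $\beta=\|b\|$. Let $u_N^{IA}$ be the approximation produced by $N$ steps of the infinite Arnoldi exponential integrator, as defined in the context. Then, for any $m\ge N$, $$u_N^{IA}=u_{N,m}.$$
   Context: $A\in\mathbb{C}^{n\times n}$, $u_0\in\mathbb{C}^n$, $w_0,w_1,\dots\in\mathbb{C}^n$, $t\in\mathbb{R}$. $H_\infty\in\mathbb{R}^{\infty\times\infty}$ is an infinite upper Hessenberg matrix (entries below the first subdiagonal vanish) with leading $N\times N$ submatrices $H_N$ (uniformly bounded in spectral norm). $W_m=[w_0\ \cdots\ w_{m-1}]$, $W_\infty=[w_0,w_1,\dots]$, $$A_m=\begin{bmatrix}A&W_m\\0&H_m\end{bmatrix},\qquad A_\infty=\begin{bmatrix}A&W_\infty\\0&H_\infty\end{bmatrix}.$$ $e_1$ is the first unit vector of consistent size. Arnoldi method for a (finite or infinite) matrix $B$ and vector $b\ne0$: $q_1=b/\beta$, $\beta=\|b\|$; for $k=1,2,\dots$, set $w=Bq_k$, $w_\perp=w-\sum_{i=1}^k(q_i^*w)q_i$, $q_{k+1}=w_\perp/\|w_\perp\|$. $N$ steps give $Q_N=[q_1,\dots,q_N]$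 with orthonormal columns and the Hessenberg matrix $F_N=Q_N^*BQ_N\in\mathbb{C}^{N\times N}$; it is assumed that $q_1,\dots,q_N$ can be generated (no breakdown). $\begin{bmatrix}I_n&0\end{bmatrix}Q_N$ denotes the first $n$ rows of $Q_N$. The infinite Arnoldi exponential integrator is this Arnoldi method applied to $B=A_\infty$ with infinite starting vector $b=[u_0^{\mathrm T},e_1^{\mathrm T}]^{\mathrm T}$ (all generated vectors are finitely supported, so only finitely many entries need be stored), and $u_N^{IA}=\begin{bmatrix}I_n&0\end{bmatrix}Q_N\exp(tF_N)e_1\beta$ with the resulting $Q_N,F_N$. *)

theory Defs
  imports "Jordan_Normal_Form.Matrix" "HOL-Analysis.Infinite_Sum"
begin

text \<open>
  Finite and infinite matrices and vectors are treated uniformly as functions over an index set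
  \<open>I\<close>: \<open>I = {..<d}\<close> for dimension \<open>d\<close> and \<open>I = UNIV\<close> for the infinite case. Over a finite
  \<open>I\<close>, and for finitely supported vectors over an infinite \<open>I\<close>, the unordered sums below are
  finite sums. All indices start at 0, so \<open>q 0, ..., q (N - 1)\<close> are the vectors usually written
  \<open>q\<^sub>1, ..., q\<^sub>N\<close>.
\<close>

definition inner_on :: "nat set \<Rightarrow> (nat \<Rightarrow> complex) \<Rightarrow> (nat \<Rightarrow> complex) \<Rightarrow> complex" where
  "inner_on I x y = (\<Sum>\<^sub>\<infinity>i\<in>I. cnj (x i) * y i)"

definition norm_on :: "nat set \<Rightarrow> (nat \<Rightarrow> complex) \<Rightarrow> real" where
  "norm_on I x = sqrt (\<Sum>\<^sub>\<infinity>i\<in>I. (cmod (x i))\<^sup>2)"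

definition mult_on :: "nat set \<Rightarrow> (nat \<Rightarrow> nat \<Rightarrow> complex) \<Rightarrow> (nat \<Rightarrow> complex) \<Rightarrow> nat \<Rightarrow> complex" where
  "mult_on I B x i = (\<Sum>\<^sub>\<infinity>j\<in>I. B i j * x j)"

definition arnoldi_residual ::
    "nat set \<Rightarrow> (nat \<Rightarrow> nat \<Rightarrow> complex) \<Rightarrow> (nat \<Rightarrow> nat \<Rightarrow> complex) \<Rightarrow> nat \<Rightarrow> nat \<Rightarrow> complex" where
  "arnoldi_residual I B q k i =
     (let w = mult_on I B (q k) in w i - (\<Sum>l\<le>k. inner_on I (q l) w * q l i))"

text \<open>
  \<open>arnoldi I B b N q\<close>: the Arnoldi method for \<open>B\<close> and \<open>b\<close> generates \<open>q 0, ..., q (N - 1)\<close>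
  without breakdown. The remaining values of \<open>q\<close> are unconstrained.
\<close>

definition arnoldi ::
    "nat set \<Rightarrow> (nat \<Rightarrow> nat \<Rightarrow> complex) \<Rightarrow> (nat \<Rightarrow> complex) \<Rightarrow> nat \<Rightarrow> (nat \<Rightarrow> nat \<Rightarrow> complex) \<Rightarrow> bool" where
  "arnoldi I B b N q \<longleftrightarrow>
     norm_on I b \<noteq> 0 \<and>
     (\<forall>i\<in>I. q 0 i = b i / complex_of_real (norm_on I b)) \<and>
     (\<forall>k. Suc k < N \<longrightarrow>
        norm_on I (arnoldi_residual I B q k) \<noteq> 0 \<and>
        (\<forall>i\<in>I. q (Suc k) i =
           arnoldi_residual I B q k i / complex_of_real (norm_on I (arnoldi_residual I B q k))))"

definition arnoldi_hessenberg ::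
    "nat set \<Rightarrow> (nat \<Rightarrow> nat \<Rightarrow> complex) \<Rightarrow> nat \<Rightarrow> (nat \<Rightarrow> nat \<Rightarrow> complex) \<Rightarrow> complex mat" where
  "arnoldi_hessenberg I B N q = mat N N (\<lambda>(i, j). inner_on I (q i) (mult_on I B (q j)))"

definition mat_exp :: "complex mat \<Rightarrow> complex mat" where
  "mat_exp M = mat (dim_row M) (dim_row M) (\<lambda>(i, j). \<Sum>k. (M ^\<^sub>m k) $$ (i, j) / fact k)"

text \<open>
  The Krylov approximation: the first \<open>n\<close> rows of the basis \<open>Q\<^sub>N = [q 0, ..., q (N - 1)]\<close>,
  applied to \<open>exp(t F\<^sub>N) e\<^sub>1 \<beta>\<close>.
\<close>

definition krylov_approx ::
    "nat set \<Rightarrow> (nat \<Rightarrow> nat \<Rightarrow> complex) \<Rightarrow> (nat \<Rightarrow> complex) \<Rightarrow> nat \<Rightarrow> real \<Rightarrow> nat \<Rightarrow>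
     (nat \<Rightarrow> nat \<Rightarrow> complex) \<Rightarrow> complex vec" where
  "krylov_approx I B b n t N q =
     complex_of_real (norm_on I b) \<cdot>\<^sub>v
       (mat n N (\<lambda>(i, j). q j i) *\<^sub>v
         (mat_exp (complex_of_real t \<cdot>\<^sub>m arnoldi_hessenberg I B N q) *\<^sub>v unit_vec N 0))"

definition leading_submat :: "(nat \<Rightarrow> nat \<Rightarrow> real) \<Rightarrow> nat \<Rightarrow> real mat" where
  "leading_submat H N = mat N N (\<lambda>(i, j). H i j)"

definition upper_hessenberg :: "(nat \<Rightarrow> nat \<Rightarrow> real) \<Rightarrow> bool" where
  "upper_hessenberg H \<longleftrightarrow> (\<forall>i j. Suc j < i \<longrightarrow> H i j = 0)"

definition spectral_norm :: "real mat \<Rightarrow> real" where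
  "spectral_norm M =
     (SUP v \<in> {v \<in> carrier_vec (dim_col M). v \<bullet> v \<le> 1}. sqrt ((M *\<^sub>v v) \<bullet> (M *\<^sub>v v)))"

definition aug_mat ::
    "nat \<Rightarrow> complex mat \<Rightarrow> (nat \<Rightarrow> complex vec) \<Rightarrow> (nat \<Rightarrow> nat \<Rightarrow> real) \<Rightarrow> nat \<Rightarrow> complex mat" where
  "aug_mat n A w H m =
     four_block_mat A (mat_of_cols n (map w [0..<m]))
       (0\<^sub>m m n) (map_mat complex_of_real (leading_submat H m))"

definition aug_mat_inf ::
    "nat \<Rightarrow> complex mat \<Rightarrow> (nat \<Rightarrow> complex vec) \<Rightarrow> (nat \<Rightarrow> nat \<Rightarrow> real) \<Rightarrow> nat \<Rightarrow> nat \<Rightarrow> complex" where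
  "aug_mat_inf n A w H i j =
     (if i < n then if j < n then A $$ (i, j) else w (j - n) $ i
      else if j < n then 0 else complex_of_real (H (i - n) (j - n)))"

definition start_vec :: "complex vec \<Rightarrow> nat \<Rightarrow> complex vec" where
  "start_vec u0 m = u0 @\<^sub>v unit_vec m 0"

definition start_vec_inf :: "nat \<Rightarrow> complex vec \<Rightarrow> nat \<Rightarrow> complex" where
  "start_vec_inf n u0 i = (if i < n then u0 $ i else if i = n then 1 else 0)"

definition krylov_approx_fin ::
    "complex mat \<Rightarrow> complex vec \<Rightarrow> nat \<Rightarrow> real \<Rightarrow> nat \<Rightarrow> (nat \<Rightarrow> nat \<Rightarrow> complex) \<Rightarrow> complex vec" where
  "krylov_approx_fin B b = krylov_approx {..<dim_vec b} (\<lambda>i j. B $$ (i, j)) (\<lambda>i. b $ i)"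

definition arnoldi_fin ::
    "complex mat \<Rightarrow> complex vec \<Rightarrow> nat \<Rightarrow> (nat \<Rightarrow> nat \<Rightarrow> complex) \<Rightarrow> bool" where
  "arnoldi_fin B b = arnoldi {..<dim_vec b} (\<lambda>i j. B $$ (i, j)) (\<lambda>i. b $ i)"

end

theory Submission
  imports Defs
begin

text \<open>
  The infinite Arnoldi method never sees more of the infinite matrix than its leading part.
  The starting vector is supported on the indices \<open>{..n}\<close>, and below row \<open>n + 1\<close> the matrix has
  Hessenberg shape, so one multiplication lengthens the support by at most one. Hence the
  \<open>k\<close>-th basis vector (counted from 0) is supported on \<open>{..n + k}\<close>, and all \<open>N\<close> basis vectors
  fit into the first \<open>n + N \<le> n + m\<close> coordinates. On vectors supported there the infinite sums
  for norms, inner products and the entries of matrix-vector products reduce to the sums over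
  the first \<open>n + m\<close> coordinates, so the infinite basis vectors are the zero extensions of the
  finite ones (\<open>arnoldi_zero_extension\<close>).

  The boundary case \<open>m = N\<close> needs care: the image of the last basis vector may have a nonzero
  entry at index \<open>n + N\<close>, outside the finite problem. This image enters the Hessenberg matrix
  only through inner products with basis vectors, which vanish at that index. So the two
  Hessenberg matrices agree, and with them the two Krylov approximations
  (\<open>krylov_approx_truncation\<close>).
\<close>

lemma infsum_UNIV_truncate:
  fixes f g :: "nat \<Rightarrow> 'a::{comm_monoid_add, t2_space}"
  assumes "\<And>i. i < d \<Longrightarrow> f i = g i" and "\<And>i. d \<le> i \<Longrightarrow> f i = 0"
  shows "infsum f UNIV = infsum g {..<d}"
  using assms by (intro infsum_cong_neutral) auto

definition zero_extension :: "nat \<Rightarrow> (nat \<Rightarrow> complex) \<Rightarrow> (nat \<Rightarrow> complex) \<Rightarrow> bool" where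
  "zero_extension d x y \<longleftrightarrow> (\<forall>i<d. y i = x i) \<and> (\<forall>i\<ge>d. y i = 0)"

lemma norm_on_zero_extension:
  assumes "zero_extension d x y"
  shows "norm_on UNIV y = norm_on {..<d} x"
  unfolding norm_on_def
  by (rule arg_cong[where f = sqrt], rule infsum_UNIV_truncate)
     (use assms in \<open>auto simp: zero_extension_def\<close>)

text \<open>
  Only one factor has to be supported below \<open>d\<close>. For the other factor agreement below \<open>d\<close>
  suffices, which is what admits the image of the last basis vector.
\<close>

lemma inner_on_zero_extension:
  assumes "zero_extension d x y" and "\<And>i. i < d \<Longrightarrow> v i = u i"
  shows "inner_on UNIV y v = inner_on {..<d} x u"
  unfolding inner_on_def
  by (rule infsum_UNIV_truncate) (use assms in \<open>auto simp: zero_extension_def\<close>)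

lemma mult_on_zero_extension:
  assumes "zero_extension d x y" and "\<And>j. j < d \<Longrightarrow> B i j = C i j"
  shows "mult_on UNIV B y i = mult_on {..<d} C x i"
  unfolding mult_on_def
  by (rule infsum_UNIV_truncate) (use assms in \<open>auto simp: zero_extension_def\<close>)

text \<open>
  The Hessenberg shape below row \<open>n + 1\<close> is what bounds the growth of the support.
\<close>

lemma mult_on_support:
  assumes hess: "\<And>i j. Suc n < i \<Longrightarrow> Suc j < i \<Longrightarrow> B i j = 0"
    and supp: "\<And>j. s < j \<Longrightarrow> x j = 0"
    and "n \<le> s" and "Suc s < i"
  shows "mult_on UNIV B x i = 0"
proof -
  have "B i j * x j = 0" for j
    using hess[of i j] supp[of j] \<open>n \<le> s\<close> \<open>Suc s < i\<close> by (cases "s < j") auto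
  then show ?thesis by (simp add: mult_on_def infsum_0)
qed

text \<open>
  The bound on the support has to be carried through the induction together with the agreement
  below \<open>d\<close>: it keeps the next residual inside the first \<open>d\<close> coordinates, so that its norm is
  the same in both methods.
\<close>

lemma arnoldi_zero_extension:
  assumes hess: "\<And>i j. Suc n < i \<Longrightarrow> Suc j < i \<Longrightarrow> B i j = 0"
    and start: "\<And>i. n < i \<Longrightarrow> b i = 0" "zero_extension d c b"
    and agree: "\<And>i j. i < d \<Longrightarrow> j < d \<Longrightarrow> B i j = C i j"
    and d: "n + N \<le> d"
    and inf: "arnoldi UNIV B b N p" and fin: "arnoldi {..<d} C c N q"
    and "k < N"
  shows "zero_extension d (q k) (p k) \<and> (\<forall>i>n + k. p k i = 0)"
  using \<open>k < N\<close>
proof (induction k rule: less_induct)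
  case (less k)
  show ?case
  proof (cases k)
    case 0
    have "p 0 i = b i / complex_of_real (norm_on UNIV b)" for i
      using inf by (simp add: arnoldi_def)
    moreover have "q 0 i = c i / complex_of_real (norm_on UNIV b)" if "i < d" for i
      using fin that norm_on_zero_extension[OF start(2)] by (simp add: arnoldi_def)
    ultimately show ?thesis
      using start 0 by (auto simp: zero_extension_def)
  next
    case (Suc k')
    let ?r = "arnoldi_residual UNIV B p k'" and ?s = "arnoldi_residual {..<d} C q k'"
    have IH: "zero_extension d (q l) (p l)" "\<And>i. n + l < i \<Longrightarrow> p l i = 0" if "l \<le> k'" for l
      using less that Suc by auto
    have mult: "mult_on UNIV B (p k') i = mult_on {..<d} C (q k') i" if "i < d" for i
      using IH(1) agree that by (intro mult_on_zero_extension) auto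
    have inner: "inner_on UNIV (p l) (mult_on UNIV B (p k')) =
        inner_on {..<d} (q l) (mult_on {..<d} C (q k'))" if "l \<le> k'" for l
      using IH(1)[OF that] mult by (rule inner_on_zero_extension)
    have res: "?r i = ?s i" if "i < d" for i
      using IH(1) that by (auto simp: arnoldi_residual_def Let_def mult inner zero_extension_def)
    have supp: "?r i = 0" if "n + k < i" for i
    proof -
      have "mult_on UNIV B (p k') i = 0"
        by (rule mult_on_support[OF hess, where s = "n + k'"]) (use IH(2) that Suc in auto)
      then show ?thesis
        using IH(2) that Suc by (simp add: arnoldi_residual_def)
    qed
    have ext: "zero_extension d ?s ?r"
      using res supp less.prems d by (auto simp: zero_extension_def)
    have "p k i = ?r i / complex_of_real (norm_on UNIV ?r)" for i
      using inf less.prems Suc by (simp add: arnoldi_def)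
    moreover have "q k i = ?s i / complex_of_real (norm_on UNIV ?r)" if "i < d" for i
      using fin less.prems Suc that norm_on_zero_extension[OF ext] by (simp add: arnoldi_def)
    ultimately show ?thesis
      using ext supp by (auto simp: zero_extension_def)
  qed
qed

theorem krylov_approx_truncation:
  assumes hess: "\<And>i j. Suc n < i \<Longrightarrow> Suc j < i \<Longrightarrow> B i j = 0"
    and start: "\<And>i. n < i \<Longrightarrow> b i = 0" "zero_extension d c b"
    and agree: "\<And>i j. i < d \<Longrightarrow> j < d \<Longrightarrow> B i j = C i j"
    and d: "n + N \<le> d" "r \<le> d"
    and inf: "arnoldi UNIV B b N p" and fin: "arnoldi {..<d} C c N q"
  shows "krylov_approx UNIV B b r t N p = krylov_approx {..<d} C c r t N q"
proof -
  have ext: "zero_extension d (q k) (p k)" if "k < N" for k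
    using arnoldi_zero_extension[OF hess start agree d(1) inf fin that] by blast
  have "arnoldi_hessenberg UNIV B N p = arnoldi_hessenberg {..<d} C N q"
    unfolding arnoldi_hessenberg_def
    by (rule cong_mat)
       (use ext agree in \<open>auto intro!: inner_on_zero_extension mult_on_zero_extension\<close>)
  moreover have "mat r N (\<lambda>(i, j). p j i) = mat r N (\<lambda>(i, j). q j i)"
    by (rule cong_mat) (use ext d(2) in \<open>auto simp: zero_extension_def\<close>)
  ultimately show ?thesis
    using norm_on_zero_extension[OF start(2)] by (simp add: krylov_approx_def)
qed

lemma aug_mat_inf_below_subdiagonal:
  assumes "upper_hessenberg H" and "Suc n < i" and "Suc j < i"
  shows "aug_mat_inf n A w H i j = 0"
  using assms by (auto simp: aug_mat_inf_def upper_hessenberg_def)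

lemma aug_mat_inf_leading:
  assumes "A \<in> carrier_mat n n" and "i < n + m" and "j < n + m"
  shows "aug_mat_inf n A w H i j = aug_mat n A w H m $$ (i, j)"
  using assms by (auto simp: aug_mat_inf_def aug_mat_def leading_submat_def mat_of_cols_def)

text \<open>
  The assumption \<open>0 < m\<close> keeps the entry 1 at index \<open>n\<close> inside the finite vector.
\<close>

lemma start_vec_inf_zero_extension:
  assumes "u0 \<in> carrier_vec n" and "0 < m"
  shows "zero_extension (n + m) (\<lambda>i. start_vec u0 m $ i) (start_vec_inf n u0)"
  using assms by (auto simp: zero_extension_def start_vec_def start_vec_inf_def)

theorem lemma6:
  fixes n m N :: nat and A :: "complex mat" and u0 :: "complex vec"
    and w :: "nat \<Rightarrow> complex vec" and H :: "nat \<Rightarrow> nat \<Rightarrow> real" and t :: real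
    and q p :: "nat \<Rightarrow> nat \<Rightarrow> complex"
  assumes "A \<in> carrier_mat n n"
    and "u0 \<in> carrier_vec n"
    and "\<And>k. w k \<in> carrier_vec n"
    and "upper_hessenberg H"
    and "bdd_above (range (\<lambda>k. spectral_norm (leading_submat H k)))"
    and "1 \<le> N" and "N \<le> m"
    and "arnoldi_fin (aug_mat n A w H m) (start_vec u0 m) N q"
    and "arnoldi UNIV (aug_mat_inf n A w H) (start_vec_inf n u0) N p"
  shows "krylov_approx UNIV (aug_mat_inf n A w H) (start_vec_inf n u0) n t N p =
         krylov_approx_fin (aug_mat n A w H m) (start_vec u0 m) n t N q"
proof -
  have dim: "dim_vec (start_vec u0 m) = n + m"
    using assms(2) by (simp add: start_vec_def)
  have "0 < m" using assms(6,7) by simp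
  show ?thesis
    unfolding krylov_approx_fin_def dim
  proof (rule krylov_approx_truncation)
    show "aug_mat_inf n A w H i j = 0" if "Suc n < i" "Suc j < i" for i j
      using assms(4) that by (rule aug_mat_inf_below_subdiagonal)
    show "start_vec_inf n u0 i = 0" if "n < i" for i
      using that by (simp add: start_vec_inf_def)
    show "zero_extension (n + m) (\<lambda>i. start_vec u0 m $ i) (start_vec_inf n u0)"
      using assms(2) \<open>0 < m\<close> by (rule start_vec_inf_zero_extension)
    show "aug_mat_inf n A w H i j = aug_mat n A w H m $$ (i, j)"
      if "i < n + m" "j < n + m" for i j
      using assms(1) that by (rule aug_mat_inf_leading)
    show "arnoldi {..<n + m} (\<lambda>i j. aug_mat n A w H m $$ (i, j)) (\<lambda>i. start_vec u0 m $ i) N q"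
      using assms(8) by (simp add: arnoldi_fin_def dim)
  qed (use assms(7,9) in simp_all)
qed

end
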